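(* Let $\mathcal{A}$ be a unital Banach algebra, let $n\geq 1$ be an integer, and let $a_0,a_1,\dots,a_n\in\mathcal{A}$ with $a_0$ and $a_n$ invertible. Let $p(z)=a_0+za_1+\cdots+z^{n-1}a_{n-1}+z^na_n\in\mathcal{A}[z]$. Let $u\in\mathcal{A}$ be such that $p(u)=0$, $u$ is invertible, and $\|(u^{-1})^n\|=\|u^{-1}\|^n$. Then $$\frac{1}{\|u^{-1}\|}>\frac{1}{1+\max_{1\leq j\leq n}\|a_ja_0^{-1}\|}\geq\frac{1}{1+\|a_0^{-1}\|\max_{1\leq j\leq n}\|a_j\|}.$$
   Context: Here $\mathcal{A}$ is a (possibly noncommutative) Banach algebra with unit $1\neq 0$, and $\mathcal{A}[z]$ is the set of polynomials over $\mathcal{A}$. In this statement coefficients are written on the right of the powers of $z$, and $p(u)$ means $p(u)=a_0+ua_1+\cdots+u^{n-1}a_{n-1}+u^na_n$. *)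

theory Defs
  imports Complex_Main "HOL-Computational_Algebra.Polynomial"
begin

definition ring_invertible :: "'a::monoid_mult \<Rightarrow> bool" where
  "ring_invertible a \<longleftrightarrow> (\<exists>b. a * b = 1 \<and> b * a = 1)"

(* Unspecified unless "ring_invertible a" holds; the class operation "inverse"
   is not available here, as it only exists for division rings. *)
definition ring_inv :: "'a::monoid_mult \<Rightarrow> 'a" where
  "ring_inv a = (THE b. a * b = 1 \<and> b * a = 1)"

lemma ring_inv_unique:
  assumes "a * b = 1" "b * a = 1"
  shows "ring_inv a = b"
  unfolding ring_inv_def
proof (rule the_equality)
  fix c assume c: "a * c = 1 \<and> c * a = 1"
  have "c = (b * a) * c" using assms by simp
  also have "\<dots> = b" using c by (simp add: mult.assoc)
  finally show "c = b" .
qed (use assms in auto)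

lemma ring_inv:
  assumes "ring_invertible a"
  shows "a * ring_inv a = 1" "ring_inv a * a = 1"
  using assms ring_inv_unique unfolding ring_invertible_def by metis+

(* Evaluation with the coefficients to the right of the powers of the point.
   The library's "poly" requires a commutative ring and cannot be used. *)
definition poly_right :: "'a::ring_1 poly \<Rightarrow> 'a \<Rightarrow> 'a" where
  "poly_right p u = (\<Sum>j\<le>degree p. u ^ j * coeff p j)"

end

theory Submission
  imports Defs
begin

text \<open>
  This is Cauchy's bound on polynomial roots, applied to the reversed polynomial.
  Put \<open>v = u\<^sup>-\<^sup>1\<close> and \<open>b\<^sub>j = a\<^sub>j a\<^sub>0\<^sup>-\<^sup>1\<close>. Multiplying \<open>p(u) = 0\<close> by \<open>v\<^sup>n\<close> on the left and by
  \<open>a\<^sub>0\<^sup>-\<^sup>1\<close> on the right gives \<open>v\<^sup>n = - (v\<^sup>n\<^sup>-\<^sup>1 b\<^sub>1 + \<dots> + v b\<^sub>n\<^sub>-\<^sub>1 + b\<^sub>n)\<close>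
  (lemma \<open>reversed_root_equation\<close>). Let \<open>r\<close> be the norm of \<open>v\<close> and \<open>M\<close> the largest norm of a
  \<open>b\<^sub>j\<close>. The hypothesis that \<open>v\<^sup>n\<close> has norm \<open>r\<^sup>n\<close> keeps the left-hand side at full size when
  norms are taken, so that \<open>r\<^sup>n \<le> M (1 + r + \<dots> + r\<^sup>n\<^sup>-\<^sup>1)\<close>, and a comparison with the geometric
  sum forces \<open>r < 1 + M\<close> (lemma \<open>geometric_sum_bound\<close>). The second inequality is
  submultiplicativity of the norm.

  The classes assumed for the algebra do not normalise the unit: its norm may exceed 1.
  The estimates therefore treat the power \<open>v\<^sup>0\<close> separately.
\<close>

lemma poly_right_sum_monom:
  fixes a :: "nat \<Rightarrow> 'a::ring_1"
  shows "poly_right (\<Sum>j\<le>n. monom (a j) j) u = (\<Sum>j\<le>n. u ^ j * a j)"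
proof -
  let ?p = "\<Sum>j\<le>n. monom (a j) j"
  have c: "coeff ?p j = (if j \<le> n then a j else 0)" for j
    by (simp add: coeff_sum sum.delta)
  have "degree ?p \<le> n"
    by (rule degree_le) (simp add: c)
  then have "poly_right ?p u = (\<Sum>j\<le>n. u ^ j * coeff ?p j)"
    unfolding poly_right_def
    by (intro sum.mono_neutral_left) (auto simp: coeff_eq_0)
  then show ?thesis by (simp add: c)
qed

text \<open>The exponent is positive because the norm of the unit may exceed 1.\<close>

lemma norm_power_Suc_le:
  fixes x :: "'a::{real_algebra_1, real_normed_algebra}"
  shows "norm (x ^ Suc k) \<le> norm x ^ Suc k"
proof (induction k)
  case (Suc k)
  have "norm (x ^ Suc (Suc k)) \<le> norm x * norm (x ^ Suc k)"
    by (metis norm_mult_ineq power_Suc)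
  also have "\<dots> \<le> norm x * norm x ^ Suc k"
    using Suc by (intro mult_left_mono) auto
  finally show ?case by simp
qed simp

text \<open>
  With a factor on the right the exponent may be zero again, since \<open>v\<^sup>0 b = b\<close> costs nothing.
\<close>

lemma norm_power_mult_le:
  fixes v b :: "'a::{real_algebra_1, real_normed_algebra}"
  shows "norm (v ^ k * b) \<le> norm v ^ k * norm b"
proof (cases k)
  case (Suc m)
  have "norm (v ^ k * b) \<le> norm (v ^ k) * norm b" by (rule norm_mult_ineq)
  also have "\<dots> \<le> norm v ^ k * norm b"
    using norm_power_Suc_le[of v m] Suc by (intro mult_right_mono) auto
  finally show ?thesis .
qed simp

text \<open>
  If \<open>M \<le> r - 1\<close>, the geometric sum times \<open>M\<close> is at most \<open>r\<^sup>n - 1\<close>, which is too small.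
\<close>

lemma geometric_sum_bound:
  fixes r M :: real
  assumes "r \<ge> 0" and le: "r ^ n \<le> M * (\<Sum>k<n. r ^ k)"
  shows "r < 1 + M"
proof (rule ccontr)
  assume "\<not> r < 1 + M"
  then have "M * (\<Sum>k<n. r ^ k) \<le> (r - 1) * (\<Sum>k<n. r ^ k)"
    using \<open>r \<ge> 0\<close> by (intro mult_right_mono sum_nonneg) auto
  also have "\<dots> = r ^ n - 1" by (simp add: power_diff_1_eq)
  finally show False using le by simp
qed

text \<open>
  Left multiplication by \<open>v\<^sup>n\<close> turns \<open>u\<^sup>j\<close> into \<open>v\<^sup>n\<^sup>-\<^sup>j\<close>, and right multiplication
  by \<open>c\<close> cancels the constant coefficient, so that \<open>v\<^sup>n\<close> alone survives from the term \<open>j = 0\<close>.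
  The substitution \<open>k = n - j\<close> lists the powers of \<open>v\<close> in ascending order.
\<close>

lemma reversed_root_equation:
  fixes a :: "nat \<Rightarrow> 'a::ring_1"
  assumes root: "(\<Sum>j\<le>n. u ^ j * a j) = 0"
    and vu: "v * u = 1" and ac: "a 0 * c = 1"
  shows "v ^ n = - (\<Sum>k<n. v ^ k * (a (n - k) * c))"
proof -
  have cancel: "v ^ n * u ^ j = v ^ (n - j)" if "j \<le> n" for j
  proof -
    have "v ^ n * u ^ j = v ^ (n - j) * (v ^ j * u ^ j)"
      using that by (metis le_add_diff_inverse2 mult.assoc power_add)
    then show ?thesis using left_right_inverse_power[OF vu] by simp
  qed
  have "0 = v ^ n * (\<Sum>j\<le>n. u ^ j * a j) * c" using root by simp
  also have "\<dots> = (\<Sum>j\<le>n. (v ^ n * u ^ j) * (a j * c))"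
    by (simp add: sum_distrib_left sum_distrib_right mult.assoc)
  also have "\<dots> = (\<Sum>j\<le>n. v ^ (n - j) * (a j * c))"
    by (intro sum.cong) (auto simp: cancel)
  also have "\<dots> = (\<Sum>k\<le>n. v ^ k * (a (n - k) * c))"
    by (rule sum.reindex_bij_witness[of _ "\<lambda>k. n - k" "\<lambda>k. n - k"]) auto
  also have "\<dots> = (\<Sum>k<n. v ^ k * (a (n - k) * c)) + v ^ n"
    using ac by (simp add: lessThan_Suc_atMost[symmetric])
  finally show ?thesis by (simp add: eq_neg_iff_add_eq_0 add.commute)
qed

theorem theorem2p6:
  fixes a :: "nat \<Rightarrow> 'a::{real_algebra_1, real_normed_algebra, banach}"
    and p :: "'a poly" and u :: 'a and n :: nat
  assumes "n \<ge> 1"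
    and "ring_invertible (a 0)" and "ring_invertible (a n)"
    and "p = (\<Sum>j\<le>n. monom (a j) j)"
    and "poly_right p u = 0"
    and "ring_invertible u"
    and "norm (ring_inv u ^ n) = norm (ring_inv u) ^ n"
  shows "1 / norm (ring_inv u) > 1 / (1 + Max ((\<lambda>j. norm (a j * ring_inv (a 0))) ` {1..n}))
    \<and> 1 / (1 + Max ((\<lambda>j. norm (a j * ring_inv (a 0))) ` {1..n}))
      \<ge> 1 / (1 + norm (ring_inv (a 0)) * Max ((\<lambda>j. norm (a j)) ` {1..n}))"
proof -
  define v where "v = ring_inv u"
  define c where "c = ring_inv (a 0)"
  define M where "M = Max ((\<lambda>j. norm (a j * c)) ` {1..n})"
  define N where "N = Max ((\<lambda>j. norm (a j)) ` {1..n})"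
  have vu: "v * u = 1" using ring_inv(2)[OF assms(6)] by (simp add: v_def)
  have ac: "a 0 * c = 1" using ring_inv(1)[OF assms(2)] by (simp add: c_def)
  have M: "norm (a j * c) \<le> M" if "j \<in> {1..n}" for j
    unfolding M_def using that by (intro Max_ge) auto
  have N: "norm (a j) \<le> N" if "j \<in> {1..n}" for j
    unfolding N_def using that by (intro Max_ge) auto
  have M0: "0 \<le> M" using \<open>n \<ge> 1\<close> by (intro order_trans[OF norm_ge_zero M[of n]]) simp
  have v0: "norm v > 0" using vu by auto
  have "(\<Sum>j\<le>n. u ^ j * a j) = 0"
    using assms(4,5) by (simp add: poly_right_sum_monom)
  then have "norm v ^ n = norm (\<Sum>k<n. v ^ k * (a (n - k) * c))"
    using reversed_root_equation[where a = a, OF _ vu ac] assms(7) by (simp add: v_def)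
  also have "\<dots> \<le> (\<Sum>k<n. norm v ^ k * M)"
  proof (rule sum_norm_le)
    fix k assume "k \<in> {..<n}"
    have "norm (v ^ k * (a (n - k) * c)) \<le> norm v ^ k * norm (a (n - k) * c)"
      by (rule norm_power_mult_le)
    also have "\<dots> \<le> norm v ^ k * M"
      using \<open>k \<in> {..<n}\<close> by (intro mult_left_mono M) auto
    finally show "norm (v ^ k * (a (n - k) * c)) \<le> norm v ^ k * M" .
  qed
  also have "\<dots> = M * (\<Sum>k<n. norm v ^ k)"
    by (simp add: sum_distrib_left mult.commute)
  finally have "norm v < 1 + M"
    by (intro geometric_sum_bound) auto
  then have 1: "1 / norm v > 1 / (1 + M)"
    using v0 by (simp add: frac_less2)
  have "M \<le> norm c * N"
    unfolding M_def
  proof (rule Max.boundedI)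
    fix x assume "x \<in> (\<lambda>j. norm (a j * c)) ` {1..n}"
    then obtain j where j: "j \<in> {1..n}" "x = norm (a j * c)" by auto
    have "x \<le> norm (a j) * norm c" using j(2) by (simp add: norm_mult_ineq)
    also have "\<dots> \<le> N * norm c" using N[OF j(1)] by (intro mult_right_mono) auto
    finally show "x \<le> norm c * N" by (simp add: mult.commute)
  qed (use \<open>n \<ge> 1\<close> in auto)
  then have "1 / (1 + M) \<ge> 1 / (1 + norm c * N)"
    using M0 by (simp add: frac_le)
  with 1 show ?thesis by (simp add: v_def c_def M_def N_def)
qed

end
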